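(* Let $G$ be a spider forest with $m$ edges. There exists a positive integer $k_0 < m$ such that $G$ is $k$-shifted antimagic for every integer $k$ with $k \geq k_0$ and for every integer $k$ with $k \leq -(m+k_0+1)$.
   Context: All graphs are finite, simple, and undirected, and have a nonempty vertex set. For integers $a \le b$, $[a,b]=\{x\in\mathbb{Z}: a\le x\le b\}$. A spider is a tree with exactly one vertex of degree greater than two. A spider forest is a graph (possibly disconnected) each of whose connected components is a spider. Let $G=(V,E)$ be a graph with $m$ edges and let $k$ be an integer (possibly negative). For a bijection $f:E\to[k+1,k+m]$, the vertex-sum of $v\in V$ is $\phi_f(v)=\sum_{e\ni v} f(e)$, the sum of the labels of the edges incident to $v$. The bijection $f$ is a $k$-shifted antimagic labeling if $\phi_f(u)\neq\phi_f(v)$ for all distinct vertices $u,v\in V$. The graph $G$ is $k$-shifted antimagic if it admits a $k$-shifted antimagic labeling. *)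

theory Defs
  imports Main
begin

text \<open>
  A graph is given by a vertex set \<open>V\<close> and a set \<open>E\<close> of two-element subsets of \<open>V\<close>. Digraphs
  with a symmetric arc relation are unsuitable as a carrier here: a label belongs to an
  undirected edge, and a symmetric pair of arcs would count as a directed cycle.
\<close>

definition simple_graph :: "'a set \<Rightarrow> 'a set set \<Rightarrow> bool" where
  "simple_graph V E \<longleftrightarrow>
     finite V \<and> V \<noteq> {} \<and> E \<subseteq> {{u, v} | u v. u \<in> V \<and> v \<in> V \<and> u \<noteq> v}"

definition incident_edges :: "'a set set \<Rightarrow> 'a \<Rightarrow> 'a set set" where
  "incident_edges E v = {e \<in> E. v \<in> e}"

definition vertex_degree :: "'a set set \<Rightarrow> 'a \<Rightarrow> nat" where
  "vertex_degree E v = card (incident_edges E v)"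

definition adjacency :: "'a set set \<Rightarrow> ('a \<times> 'a) set" where
  "adjacency E = {(u, v). {u, v} \<in> E}"

definition connected_graph :: "'a set \<Rightarrow> 'a set set \<Rightarrow> bool" where
  "connected_graph V E \<longleftrightarrow> (\<forall>u\<in>V. \<forall>v\<in>V. (u, v) \<in> (adjacency E)\<^sup>*)"

text \<open>A cycle is listed by its distinct vertices; the edge closing it up is \<open>{last vs, hd vs}\<close>.\<close>

definition graph_cycle :: "'a set set \<Rightarrow> 'a list \<Rightarrow> bool" where
  "graph_cycle E vs \<longleftrightarrow>
     3 \<le> length vs \<and> distinct vs \<and>
     successively (\<lambda>u v. {u, v} \<in> E) vs \<and> {last vs, hd vs} \<in> E"

definition tree_graph :: "'a set \<Rightarrow> 'a set set \<Rightarrow> bool" where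
  "tree_graph V E \<longleftrightarrow>
     simple_graph V E \<and> connected_graph V E \<and> (\<nexists>vs. graph_cycle E vs)"

definition spider :: "'a set \<Rightarrow> 'a set set \<Rightarrow> bool" where
  "spider V E \<longleftrightarrow> tree_graph V E \<and> (\<exists>!v. v \<in> V \<and> vertex_degree E v > 2)"

text \<open>The connected components, each as the subgraph induced on a reachability class.\<close>

definition graph_components :: "'a set \<Rightarrow> 'a set set \<Rightarrow> ('a set \<times> 'a set set) set" where
  "graph_components V E =
     (\<lambda>v. let C = (adjacency E)\<^sup>* `` {v} in (C, {e \<in> E. e \<subseteq> C})) ` V"

definition spider_forest :: "'a set \<Rightarrow> 'a set set \<Rightarrow> bool" where
  "spider_forest V E \<longleftrightarrow>
     simple_graph V E \<and> (\<forall>(W, F) \<in> graph_components V E. spider W F)"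

definition vertex_sum :: "'a set set \<Rightarrow> ('a set \<Rightarrow> int) \<Rightarrow> 'a \<Rightarrow> int" where
  "vertex_sum E f v = (\<Sum>e\<in>incident_edges E v. f e)"

definition shifted_antimagic_labeling ::
    "int \<Rightarrow> 'a set \<Rightarrow> 'a set set \<Rightarrow> ('a set \<Rightarrow> int) \<Rightarrow> bool" where
  "shifted_antimagic_labeling k V E f \<longleftrightarrow>
     bij_betw f E {k + 1..k + int (card E)} \<and>
     (\<forall>u\<in>V. \<forall>v\<in>V. u \<noteq> v \<longrightarrow> vertex_sum E f u \<noteq> vertex_sum E f v)"

definition shifted_antimagic :: "int \<Rightarrow> 'a set \<Rightarrow> 'a set set \<Rightarrow> bool" where
  "shifted_antimagic k V E \<longleftrightarrow> (\<exists>f. shifted_antimagic_labeling k V E f)"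

end

theory Submission
  imports Defs "HOL-Library.Product_Lexorder"
begin

text \<open>
  Take \<open>k\<^sub>0 = m - 1\<close>. Root every spider at its center, identify each edge with its lower end and
  give out the labels in increasing order from the deepest edges to those at the centers. Within
  each depth, order the edges by the degree of the center, then by the center, then by the leg.
  For \<open>k \<ge> m - 1\<close> all labels are positive and the sum of two exceeds every label, so leaves lie below
  all other vertices. Vertices of degree two are ordered like their upper edges, because their lower
  edges are ordered in the same way. If the lower edge of such a vertex has label \<open>x\<close>, its sum is
  at most \<open>x + k + m\<close>, while the three or more edges at any center have labels above \<open>x\<close>; since
  \<open>3 (x + 1) > x + k + m\<close>, centers lie above. Finally, of two centers the later one has at least as
  many edges, all with larger labels. Negating a labeling handles the negative shifts.
\<close>

section \<open>Order-preserving labelings\<close>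

text \<open>Each element gets \<open>k + 1\<close> plus its rank, the number of elements with a
  smaller key. Ranks are distinct and below \<open>card A\<close>, so they fill the
  interval.\<close>

lemma bij_betw_rank:
  fixes g :: "'a \<Rightarrow> 'b::linorder" and k :: int
  assumes fin: "finite A" and inj: "inj_on g A"
  obtains f where "bij_betw f A {k + 1..k + int (card A)}"
    and "\<And>x y. \<lbrakk>x \<in> A; y \<in> A; g x < g y\<rbrakk> \<Longrightarrow> f x < f y"
proof -
  define r where "r x = card {y \<in> A. g y < g x}" for x
  have mono: "r x < r y" if "x \<in> A" "y \<in> A" "g x < g y" for x y
    unfolding r_def using fin that by (intro psubset_card_mono) auto
  have lt: "r x < card A" if "x \<in> A" for x
    unfolding r_def using fin that by (intro psubset_card_mono) auto
  define f where "f x = k + 1 + int (r x)" for x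
  have mono_f: "f x < f y" if "x \<in> A" "y \<in> A" "g x < g y" for x y
    using mono[OF that] by (simp add: f_def)
  have "inj_on f A"
  proof (rule inj_onI)
    fix x y assume xy: "x \<in> A" "y \<in> A" "f x = f y"
    then have "\<not> g x < g y" "\<not> g y < g x"
      using mono_f by (metis less_irrefl)+
    then show "x = y"
      using inj xy by (auto dest: inj_onD)
  qed
  moreover have "f ` A \<subseteq> {k + 1..k + int (card A)}"
    using lt by (fastforce simp: f_def)
  ultimately have "bij_betw f A {k + 1..k + int (card A)}"
    unfolding bij_betw_def by (simp add: card_image card_subset_eq)
  then show thesis
    using that mono_f by blast
qed

text \<open>The maximum \<open>M\<close> on \<open>A\<close> separates the two families; positivity
  of \<open>M\<close> lets \<open>card A\<close> be replaced by the possibly larger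
  \<open>card B\<close>. This serves to compare two centers.\<close>

lemma sum_less_sum_of_dominated:
  fixes f :: "'a \<Rightarrow> int"
  assumes fin: "finite A" "finite B" and ne: "A \<noteq> {}" and card: "card A \<le> card B"
    and pos: "\<And>a. a \<in> A \<Longrightarrow> 0 < f a"
    and less: "\<And>a b. \<lbrakk>a \<in> A; b \<in> B\<rbrakk> \<Longrightarrow> f a < f b"
  shows "sum f A < sum f B"
proof -
  define M where "M = Max (f ` A)"
  have M: "M \<in> f ` A" "\<And>a. a \<in> A \<Longrightarrow> f a \<le> M"
    using fin ne by (auto simp: M_def)
  have "M > 0"
    using M(1) pos by auto
  have "0 < card A"
    using fin ne by (simp add: card_gt_0_iff)
  have "sum f A \<le> int (card A) * M"
    using sum_bounded_above[of A f M] M(2) by simp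
  also have "\<dots> \<le> int (card B) * M"
    using card \<open>M > 0\<close> by (simp add: mult_right_mono)
  also have "\<dots> < int (card B) * (M + 1)"
    using card \<open>0 < card A\<close> by (simp add: algebra_simps)
  also have "\<dots> \<le> sum f B"
  proof -
    have "M + 1 \<le> f b" if "b \<in> B" for b
      using M(1) less[OF _ that] by force
    then show ?thesis
      using sum_bounded_below[of B "M + 1" f] by simp
  qed
  finally show ?thesis .
qed

section \<open>Paths and cycles\<close>

text \<open>Prepending a vertex that already occurs would create a loop; cutting the path at that
  occurrence removes it.\<close>

lemma rtrancl_imp_distinct_path:
  assumes "(x, y) \<in> r\<^sup>*"
  shows "\<exists>xs. xs \<noteq> [] \<and> hd xs = x \<and> last xs = y \<and> distinct xs \<and>
    successively (\<lambda>a b. (a, b) \<in> r) xs"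
  using assms
proof (induction rule: converse_rtrancl_induct)
  case base
  show ?case
    by (rule exI[of _ "[y]"]) simp
next
  case (step x z)
  then obtain xs where xs: "xs \<noteq> []" "hd xs = z" "last xs = y" "distinct xs"
    "successively (\<lambda>a b. (a, b) \<in> r) xs"
    by blast
  show ?case
  proof (cases "x \<in> set xs")
    case True
    then obtain as bs where "xs = as @ x # bs"
      by (meson split_list)
    with xs show ?thesis
      by (intro exI[of _ "x # bs"]) (auto simp: successively_append_iff)
  next
    case False
    with xs step(1) show ?thesis
      by (intro exI[of _ "x # xs"]) (cases xs, auto)
  qed
qed

lemma successively_adjacency_reach:
  assumes "successively (\<lambda>u v. {u, v} \<in> E) xs" "x \<in> set xs"
  shows "(hd xs, x) \<in> (adjacency E)\<^sup>*"
  using assms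
proof (induction xs arbitrary: x)
  case (Cons a xs)
  show ?case
  proof (cases "x = a")
    case False
    with Cons.prems have "x \<in> set xs" "xs \<noteq> []"
      by auto
    moreover from this Cons.prems have "{a, hd xs} \<in> E" "successively (\<lambda>u v. {u, v} \<in> E) xs"
      by (auto simp: successively_Cons)
    ultimately show ?thesis
      using Cons.IH by (auto simp: adjacency_def intro: converse_rtrancl_into_rtrancl)
  qed simp
qed simp

text \<open>A simple path between the ends of an edge that avoids the edge closes up to a cycle. It
  has at least three vertices, since a two-vertex path would use the removed edge.\<close>

lemma acyclic_imp_bridge:
  assumes acyclic: "\<nexists>vs. graph_cycle E vs" and e: "{u, v} \<in> E" and "u \<noteq> v"
  shows "(u, v) \<notin> (adjacency (E - {{u, v}}))\<^sup>*"
proof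
  assume "(u, v) \<in> (adjacency (E - {{u, v}}))\<^sup>*"
  from rtrancl_imp_distinct_path[OF this] obtain xs where
    xs: "xs \<noteq> []" "hd xs = u" "last xs = v" "distinct xs"
    and path: "successively (\<lambda>a b. (a, b) \<in> adjacency (E - {{u, v}})) xs"
    by blast
  have "3 \<le> length xs"
  proof (rule ccontr)
    assume "\<not> 3 \<le> length xs"
    then consider "length xs = 0" | "length xs = 1" | "length xs = 2"
      by linarith
    then show False
      using xs path \<open>u \<noteq> v\<close>
      by cases (auto simp: length_Suc_conv numeral_2_eq_2 adjacency_def)
  qed
  moreover have "successively (\<lambda>a b. {a, b} \<in> E) xs"
    using path by (rule successively_mono) (auto simp: adjacency_def)
  ultimately have "graph_cycle E xs"
    using xs e by (simp add: graph_cycle_def insert_commute)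
  with acyclic show False
    by blast
qed

section \<open>Spider forests as rooted forests\<close>

text \<open>Spider forests restated by reachability in the whole graph, so that later arguments need
  no edge sets of single components.\<close>

locale centered_forest =
  fixes V :: "'a set" and E :: "'a set set"
  assumes simple: "simple_graph V E"
    and acyclic: "\<nexists>vs. graph_cycle E vs"
    and center_exists: "v \<in> V \<Longrightarrow> \<exists>c. (v, c) \<in> (adjacency E)\<^sup>* \<and> vertex_degree E c > 2"
    and center_unique: "\<lbrakk>(c, c') \<in> (adjacency E)\<^sup>*; vertex_degree E c > 2; vertex_degree E c' > 2\<rbrakk>
      \<Longrightarrow> c = c'"
begin

lemma finite_V: "finite V"
  using simple by (simp add: simple_graph_def)

lemma edge_in_V: "{u, v} \<in> E \<Longrightarrow> u \<in> V \<and> v \<in> V \<and> u \<noteq> v"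
  using simple unfolding simple_graph_def by (auto simp: doubleton_eq_iff)

lemma edgeE:
  assumes "e \<in> E"
  obtains u v where "e = {u, v}" "u \<in> V" "v \<in> V" "u \<noteq> v"
  using simple assms unfolding simple_graph_def by blast

lemma finite_E: "finite E"
proof (rule finite_subset)
  show "E \<subseteq> Pow V"
    by (auto elim!: edgeE)
qed (simp add: finite_V)

lemma finite_incident: "finite (incident_edges E v)"
  using finite_E by (simp add: incident_edges_def)

lemma incidentE:
  assumes "e \<in> incident_edges E v"
  obtains w where "e = {v, w}" "{v, w} \<in> E"
proof -
  have e: "e \<in> E" "v \<in> e"
    using assms by (auto simp: incident_edges_def)
  obtain x y where "e = {x, y}"
    using e(1) by (rule edgeE)
  with e(2) have "e = {v, x} \<or> e = {v, y}"
    by auto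
  with e(1) show thesis
    using that by auto
qed

lemma sym_adjacency: "sym ((adjacency E)\<^sup>*)"
  by (rule sym_rtrancl) (auto simp: sym_def adjacency_def insert_commute)

section \<open>Distance to the center\<close>

text \<open>The distance to a nearest center. As each component has only one, this is the level in
  the tree rooted at it.\<close>

definition depth :: "'a \<Rightarrow> nat" where
  "depth v = (LEAST n. \<exists>c. vertex_degree E c > 2 \<and> (v, c) \<in> adjacency E ^^ n)"

lemma depth_path:
  assumes "v \<in> V"
  shows "\<exists>c. vertex_degree E c > 2 \<and> (v, c) \<in> adjacency E ^^ depth v"
proof -
  have "\<exists>n c. vertex_degree E c > 2 \<and> (v, c) \<in> adjacency E ^^ n"
    using center_exists[OF assms] by (metis rtrancl_power)
  then show ?thesis
    unfolding depth_def by (rule LeastI_ex)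
qed

lemma depth_le: "\<lbrakk>vertex_degree E c > 2; (v, c) \<in> adjacency E ^^ n\<rbrakk> \<Longrightarrow> depth v \<le> n"
  unfolding depth_def by (rule Least_le) blast

lemma depth_eq_0_iff: "v \<in> V \<Longrightarrow> depth v = 0 \<longleftrightarrow> vertex_degree E v > 2"
  using depth_path[of v] depth_le[of v v 0] by (cases "depth v = 0") auto

lemma depth_edge_le:
  assumes "{u, v} \<in> E"
  shows "depth u \<le> Suc (depth v)"
proof -
  obtain c where "vertex_degree E c > 2" "(v, c) \<in> adjacency E ^^ depth v"
    using depth_path edge_in_V[OF assms] by blast
  moreover from this have "(u, c) \<in> adjacency E ^^ Suc (depth v)"
    using assms by (intro relpow_Suc_I2) (auto simp: adjacency_def)
  ultimately show ?thesis
    by (blast intro: depth_le)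
qed

text \<open>Take the second vertex of a shortest path to a center. The rest of the path bounds its
  depth from above, and depth changes by at most one along an edge.\<close>

lemma ex_parent:
  assumes "v \<in> V" "depth v > 0"
  shows "\<exists>u. {v, u} \<in> E \<and> depth v = Suc (depth u)"
proof -
  obtain n where n: "depth v = Suc n"
    using assms(2) gr0_conv_Suc by blast
  then obtain c where c: "vertex_degree E c > 2" "(v, c) \<in> adjacency E ^^ Suc n"
    using depth_path[OF assms(1)] by auto
  then obtain u where u: "(v, u) \<in> adjacency E" "(u, c) \<in> adjacency E ^^ n"
    by (meson relpow_Suc_D2)
  from u(1) have e: "{v, u} \<in> E"
    by (simp add: adjacency_def)
  have "depth u \<le> n"
    using depth_le c(1) u(2) by blast
  with depth_edge_le[OF e] n e show ?thesis
    by (intro exI[of _ u]) auto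
qed

text \<open>Repeated passage to a vertex one level closer. The bound by \<open>depth v\<close> is
  kept in the relation so that the path visibly avoids edges whose lower end is deeper than
  \<open>v\<close>.\<close>

lemma descending_path:
  assumes "v \<in> V"
  shows "\<exists>c. vertex_degree E c > 2 \<and>
    (v, c) \<in> {(a, b). {a, b} \<in> E \<and> depth a = Suc (depth b) \<and> depth a \<le> depth v}\<^sup>*"
  using assms
proof (induction "depth v" arbitrary: v)
  case 0
  then show ?case
    using depth_eq_0_iff by auto
next
  case (Suc n)
  then obtain u where u: "{v, u} \<in> E" "depth v = Suc (depth u)"
    using ex_parent[of v] by auto
  then have "n = depth u" "u \<in> V"
    using Suc.hyps(2) edge_in_V by auto
  then obtain c where c: "vertex_degree E c > 2"
    "(u, c) \<in> {(a, b). {a, b} \<in> E \<and> depth a = Suc (depth b) \<and> depth a \<le> depth u}\<^sup>*"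
    using Suc.hyps(1) by blast
  have "(u, c) \<in> {(a, b). {a, b} \<in> E \<and> depth a = Suc (depth b) \<and> depth a \<le> depth v}\<^sup>*"
    by (rule subsetD[OF rtrancl_mono c(2)]) (use u in auto)
  with u c(1) show ?case
    by (intro exI[of _ c]) (auto intro: converse_rtrancl_into_rtrancl)
qed

text \<open>
  The premises say that \<open>e\<close> does not lie on the descending paths from \<open>u\<close> and \<open>v\<close> to their
  common center.
\<close>

lemma connected_avoiding:
  assumes conn: "(u, v) \<in> (adjacency E)\<^sup>*" and V: "u \<in> V" "v \<in> V"
    and u: "\<And>a b. \<lbrakk>{a, b} = e; depth a = Suc (depth b)\<rbrakk> \<Longrightarrow> depth u < depth a"
    and v: "\<And>a b. \<lbrakk>{a, b} = e; depth a = Suc (depth b)\<rbrakk> \<Longrightarrow> depth v < depth a"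
  shows "(u, v) \<in> (adjacency (E - {e}))\<^sup>*"
proof -
  have avoid: "\<exists>c. vertex_degree E c > 2 \<and> (x, c) \<in> (adjacency (E - {e}))\<^sup>*"
    if x: "x \<in> V"
      and le: "\<And>a b. \<lbrakk>{a, b} = e; depth a = Suc (depth b)\<rbrakk> \<Longrightarrow> depth x < depth a" for x
  proof -
    obtain c where c: "vertex_degree E c > 2"
      "(x, c) \<in> {(a, b). {a, b} \<in> E \<and> depth a = Suc (depth b) \<and> depth a \<le> depth x}\<^sup>*"
      using descending_path[OF x] by blast
    have "(x, c) \<in> (adjacency (E - {e}))\<^sup>*"
      by (rule subsetD[OF rtrancl_mono c(2)]) (use le in \<open>force simp: adjacency_def\<close>)
    with c(1) show ?thesis
      by blast
  qed
  have sub: "(adjacency (E - {e}))\<^sup>* \<subseteq> (adjacency E)\<^sup>*"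
    by (rule rtrancl_mono) (auto simp: adjacency_def)
  have sym: "sym ((adjacency (E - {e}))\<^sup>*)"
    by (rule sym_rtrancl) (auto simp: sym_def adjacency_def insert_commute)
  obtain c where c: "vertex_degree E c > 2" "(u, c) \<in> (adjacency (E - {e}))\<^sup>*"
    using avoid[OF V(1)] u by blast
  obtain c' where c': "vertex_degree E c' > 2" "(v, c') \<in> (adjacency (E - {e}))\<^sup>*"
    using avoid[OF V(2)] v by blast
  have "(c, c') \<in> (adjacency E)\<^sup>*"
    using conn c(2) c'(2) sub sym_adjacency by (meson rtrancl_trans subsetD symD)
  then have "c = c'"
    using center_unique c(1) c'(1) by blast
  then show ?thesis
    using c(2) c'(2) sym by (meson rtrancl_trans symD)
qed

text \<open>An edge within a level is used by no descent, so its ends would be joined through their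
  center without it, although it is a bridge.\<close>

lemma depth_edge_neq:
  assumes e: "{u, v} \<in> E"
  shows "depth u \<noteq> depth v"
proof
  assume eq: "depth u = depth v"
  have "(u, v) \<in> (adjacency (E - {{u, v}}))\<^sup>*"
    by (rule connected_avoiding)
      (use e eq edge_in_V[OF e] in \<open>auto simp: adjacency_def doubleton_eq_iff\<close>)
  then show False
    using acyclic_imp_bridge[OF acyclic e] edge_in_V[OF e] by blast
qed

text \<open>Both candidates are closer to the center than \<open>v\<close>, so they are joined
  without the edge from \<open>v\<close> to \<open>u\<close>. Going from \<open>v\<close> to
  \<open>w\<close> first then bypasses this bridge.\<close>

lemma parent_unique:
  assumes u: "{v, u} \<in> E" "depth v = Suc (depth u)"
    and w: "{v, w} \<in> E" "depth v = Suc (depth w)"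
  shows "u = w"
proof (rule ccontr)
  assume "u \<noteq> w"
  have V: "u \<in> V" "w \<in> V" "v \<noteq> u"
    using edge_in_V u w by blast+
  have "(w, u) \<in> (adjacency (E - {{v, u}}))\<^sup>*"
  proof (rule connected_avoiding)
    have "(w, v) \<in> adjacency E" "(v, u) \<in> adjacency E"
      using u w by (auto simp: adjacency_def insert_commute)
    then show "(w, u) \<in> (adjacency E)\<^sup>*"
      by auto
  qed (use V u w in \<open>auto simp: doubleton_eq_iff\<close>)
  moreover have "(v, w) \<in> adjacency (E - {{v, u}})"
    using w \<open>u \<noteq> w\<close> by (auto simp: adjacency_def doubleton_eq_iff)
  ultimately have "(v, u) \<in> (adjacency (E - {{v, u}}))\<^sup>*"
    by (rule converse_rtrancl_into_rtrancl[rotated])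
  then show False
    using acyclic_imp_bridge[OF acyclic u(1)] V by blast
qed

section \<open>Parents and lower ends of edges\<close>

definition parent :: "'a \<Rightarrow> 'a" where
  "parent v = (THE u. {v, u} \<in> E \<and> depth v = Suc (depth u))"

lemma parent_eq: "\<lbrakk>{v, u} \<in> E; depth v = Suc (depth u)\<rbrakk> \<Longrightarrow> parent v = u"
  unfolding parent_def using parent_unique by blast

lemma parent_edge:
  assumes "v \<in> V" "depth v > 0"
  shows "{v, parent v} \<in> E" "depth v = Suc (depth (parent v))" "parent v \<in> V"
  using ex_parent[OF assms] parent_eq edge_in_V by blast+

text \<open>The edge with lower end \<open>v\<close>. It is meaningful only for
  \<open>depth v > 0\<close>, since \<open>parent\<close> is unspecified at centers.\<close>

abbreviation up :: "'a \<Rightarrow> 'a set" where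
  "up v \<equiv> {v, parent v}"

lemma edge_is_up:
  assumes "{u, v} \<in> E"
  shows "parent u = v \<and> depth u = Suc (depth v) \<or> parent v = u \<and> depth v = Suc (depth u)"
proof -
  have e: "{v, u} \<in> E"
    using assms by (simp add: insert_commute)
  have "depth u = Suc (depth v) \<or> depth v = Suc (depth u)"
    using depth_edge_le[OF assms] depth_edge_le[OF e] depth_edge_neq[OF assms] by linarith
  then show ?thesis
    using parent_eq assms e by blast
qed

text \<open>Every edge joins consecutive levels, hence is the upward edge of its deeper end; two
  vertices sharing an upward edge would each be the parent of the other. Labeling edges thus amounts
  to labeling noncenter vertices.\<close>

lemma bij_betw_up: "bij_betw up {v \<in> V. depth v > 0} E"
  unfolding bij_betw_def
proof
  show "inj_on up {v \<in> V. depth v > 0}"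
  proof (rule inj_onI)
    fix v w assume *: "v \<in> {v \<in> V. depth v > 0}" "w \<in> {v \<in> V. depth v > 0}" "up v = up w"
    then show "v = w"
      using parent_edge[of v] parent_edge[of w] by (force simp: doubleton_eq_iff)
  qed
  show "up ` {v \<in> V. depth v > 0} = E"
  proof
    show "up ` {v \<in> V. depth v > 0} \<subseteq> E"
      using parent_edge by blast
    show "E \<subseteq> up ` {v \<in> V. depth v > 0}"
    proof
      fix e assume "e \<in> E"
      then obtain u v where uv: "e = {u, v}" "u \<in> V" "v \<in> V"
        by (rule edgeE)
      have "\<exists>x\<in>{u, v}. depth x > 0 \<and> e = up x"
        using edge_is_up[of u v] \<open>e \<in> E\<close> uv by auto
      with uv show "e \<in> up ` {v \<in> V. depth v > 0}"
        by auto
    qed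
  qed
qed

lemma up_eq_iff:
  assumes "v \<in> V" "depth v > 0" "w \<in> V" "depth w > 0"
  shows "up v = up w \<longleftrightarrow> v = w"
  using bij_betw_up assms unfolding bij_betw_def inj_on_def by blast

lemma up_in_E: "\<lbrakk>v \<in> V; depth v > 0\<rbrakk> \<Longrightarrow> up v \<in> E"
  by (rule parent_edge)

section \<open>Edges at a vertex, and legs\<close>

lemma incident_cases:
  assumes "e \<in> incident_edges E v"
  shows "depth v > 0 \<and> e = up v \<or> (\<exists>w\<in>V. depth w = Suc (depth v) \<and> parent w = v \<and> e = up w)"
proof -
  obtain w where w: "e = {v, w}" "{v, w} \<in> E"
    using assms by (rule incidentE)
  then show ?thesis
    using edge_is_up[OF w(2)] edge_in_V[OF w(2)] by (auto simp: insert_commute)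
qed

lemma up_incident:
  assumes "v \<in> V" "depth v > 0"
  shows "up v \<in> incident_edges E v" "up v \<in> incident_edges E (parent v)"
  using parent_edge[OF assms] by (auto simp: incident_edges_def)

text \<open>Two children and the upward edge would give \<open>v\<close> degree three and make it a
  center.\<close>

lemma child_unique:
  assumes v: "depth v > 0"
    and w: "w \<in> V" "depth w = Suc (depth v)" "parent w = v"
    and w': "w' \<in> V" "depth w' = Suc (depth v)" "parent w' = v"
  shows "w = w'"
proof (rule ccontr)
  assume "w \<noteq> w'"
  have "v \<in> V"
    using parent_edge[of w] w by auto
  have "up v \<noteq> up w" "up v \<noteq> up w'" "up w \<noteq> up w'"
    using up_eq_iff \<open>v \<in> V\<close> v w w' \<open>w \<noteq> w'\<close> by (metis n_not_Suc_n zero_less_Suc)+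
  then have "card {up v, up w, up w'} = 3"
    by simp
  moreover have "{up v, up w, up w'} \<subseteq> incident_edges E v"
    using up_incident[of v] up_incident[of w] up_incident[of w'] \<open>v \<in> V\<close> v w w' by auto
  ultimately have "vertex_degree E v \<ge> 3"
    unfolding vertex_degree_def using card_mono[OF finite_incident] by metis
  then show False
    using depth_eq_0_iff[OF \<open>v \<in> V\<close>] v by simp
qed

lemma incident_noncenter:
  assumes v: "v \<in> V" "depth v > 0"
  obtains (leaf) "incident_edges E v = {up v}"
  | (inner) w where "w \<in> V" "depth w = Suc (depth v)" "parent w = v" "up v \<noteq> up w"
      "incident_edges E v = {up v, up w}"
proof (cases "\<exists>w\<in>V. depth w = Suc (depth v) \<and> parent w = v")
  case True
  then obtain w where w: "w \<in> V" "depth w = Suc (depth v)" "parent w = v"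
    by blast
  have "incident_edges E v \<subseteq> {up v, up w}"
  proof
    fix e assume "e \<in> incident_edges E v"
    then show "e \<in> {up v, up w}"
      using incident_cases[of e v] child_unique[OF v(2) _ _ _ w] by auto
  qed
  then have "incident_edges E v = {up v, up w}"
    using up_incident[OF v] up_incident[of w] w by auto
  moreover have "up v \<noteq> up w"
    using up_eq_iff v w by (metis n_not_Suc_n zero_less_Suc)
  ultimately show thesis
    using inner w by blast
next
  case False
  then have "incident_edges E v = {up v}"
    using incident_cases[of _ v] up_incident[OF v] by blast
  then show thesis
    by (rule leaf)
qed

text \<open>The top vertex of the leg containing \<open>v\<close>; junk at the centers.\<close>

definition leg :: "'a \<Rightarrow> 'a" where
  "leg v = (parent ^^ (depth v - 1)) v"

lemma leg_depth_1: "depth v = 1 \<Longrightarrow> leg v = v"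
  by (simp add: leg_def)

lemma leg_child: "\<lbrakk>depth v > 0; depth w = Suc (depth v); parent w = v\<rbrakk> \<Longrightarrow> leg w = leg v"
  unfolding leg_def by (cases "depth v") (simp_all add: funpow_swap1)

text \<open>Induction along the leg: the parents agree by hypothesis, and a parent that is not a
  center has only one child. At depth one, where the parent is a center, \<open>leg\<close> is the
  identity.\<close>

lemma leg_inj:
  assumes "v \<in> V" "w \<in> V" "depth v > 0" "depth v = depth w" "leg v = leg w"
  shows "v = w"
  using assms
proof (induction "depth v" arbitrary: v w)
  case (Suc n)
  show ?case
  proof (cases "n = 0")
    case True
    then show ?thesis
      using Suc leg_depth_1 by (metis One_nat_def)
  next
    case False
    note v = parent_edge[OF Suc.prems(1,3)]
    note w = parent_edge[OF Suc.prems(2)]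
    have d: "depth (parent v) = n" "depth (parent w) = n" "parent w \<in> V"
      using Suc v w by auto
    have "parent v = parent w"
    proof (rule Suc.hyps(1))
      show "leg (parent v) = leg (parent w)"
        using leg_child[of "parent v" v] leg_child[of "parent w" w] d False Suc by simp
    qed (use d v False in auto)
    show ?thesis
    proof (rule child_unique[OF _ Suc.prems(1) v(2) refl Suc.prems(2)])
      show "depth (parent v) > 0"
        using d(1) False by simp
      show "depth w = Suc (depth (parent v))" "parent w = parent v"
        using v(2) Suc.prems(4) \<open>parent v = parent w\<close> by simp_all
    qed
  qed
qed simp

section \<open>The labeling\<close>

lemma noncenter_sum:
  assumes v: "v \<in> V" "depth v > 0"
  obtains (leaf) "vertex_sum E f v = f (up v)"
  | (inner) w where "w \<in> V" "depth w = Suc (depth v)" "parent w = v"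
      "vertex_sum E f v = f (up v) + f (up w)"
  using v by (rule incident_noncenter) (auto simp: vertex_sum_def)

text \<open>Makes the threshold \<open>card E - 1\<close> positive, and with it every label for
  shifts from there on.\<close>

lemma edge_count_ge_3: "card E \<ge> 3"
proof -
  obtain v where "v \<in> V"
    using simple by (auto simp: simple_graph_def)
  then obtain c where "vertex_degree E c > 2"
    using center_exists by blast
  moreover have "vertex_degree E c \<le> card E"
    unfolding vertex_degree_def incident_edges_def using finite_E by (intro card_mono) auto
  ultimately show ?thesis
    by linarith
qed

lemma shifted_antimagic_large_shift:
  assumes k: "k \<ge> int (card E) - 1"
  shows "shifted_antimagic k V E"
proof -
  define m where "m = int (card E)"
  obtain idx :: "'a \<Rightarrow> nat" where idx: "inj_on idx V"
    using finite_V finite_imp_inj_to_nat_seg by metis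
  \<comment> \<open>Here \<open>parent (leg v)\<close> is the center, and \<open>idx\<close> breaks
    ties between centers and between legs. The key is constant along a leg, so each level is ordered
    like the one above it.\<close>
  define legkey where
    "legkey v = (vertex_degree E (parent (leg v)), idx (parent (leg v)), idx (leg v))" for v
  define key where "key v = (- int (depth v), legkey v)" for v
  have leg_V: "leg v \<in> V" if "v \<in> V" "depth v > 0" for v
    using that
  proof (induction "depth v" arbitrary: v)
    case (Suc n)
    then show ?case
      using leg_child[of "parent v" v] leg_depth_1[of v] parent_edge[of v]
      by (cases "n = 0") auto
  qed simp
  have legkey_inj: "v = w"
    if "v \<in> V" "w \<in> V" "depth v > 0" "depth v = depth w" "legkey v = legkey w" for v w
  proof (rule leg_inj)
    show "leg v = leg w"
      using that leg_V idx by (auto simp: legkey_def dest: inj_onD)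
  qed (use that in auto)
  have "inj_on key {v \<in> V. depth v > 0}"
    using legkey_inj by (auto simp: inj_on_def key_def)
  moreover have "finite {v \<in> V. depth v > 0}"
    using finite_V by simp
  moreover have card: "card {v \<in> V. depth v > 0} = card E"
    using bij_betw_up by (rule bij_betw_same_card)
  ultimately obtain h where h: "bij_betw h {v \<in> V. depth v > 0} {k + 1..k + m}"
    and h_mono: "\<And>x y. \<lbrakk>x \<in> {v \<in> V. depth v > 0}; y \<in> {v \<in> V. depth v > 0}; key x < key y\<rbrakk>
      \<Longrightarrow> h x < h y"
    using bij_betw_rank[of "{v \<in> V. depth v > 0}" key k] unfolding m_def by auto
  define f where "f = h \<circ> the_inv_into {v \<in> V. depth v > 0} up"
  have f_bij: "bij_betw f E {k + 1..k + m}"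
    unfolding f_def using bij_betw_the_inv_into[OF bij_betw_up] h by (rule bij_betw_trans)
  have f_up: "f (up v) = h v" if "v \<in> V" "depth v > 0" for v
    using the_inv_into_f_f[OF bij_betw_imp_inj_on[OF bij_betw_up], of v] that by (simp add: f_def)
  have f_range: "k + 1 \<le> f e" "f e \<le> k + m" if "e \<in> E" for e
    using f_bij that by (auto dest: bij_betwE)
  have deeper: "f (up w) < f (up v)"
    if "v \<in> V" "w \<in> V" "depth v > 0" "depth v < depth w" for v w
    using that f_up h_mono by (simp add: key_def)
  have same_depth: "f (up v) < f (up w)"
    if "v \<in> V" "w \<in> V" "depth v > 0" "depth v = depth w" "legkey v < legkey w" for v w
    using that f_up h_mono by (simp add: key_def)
  have m: "m \<ge> 3" "k \<ge> m - 1"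
    using edge_count_ge_3 k by (simp_all add: m_def)
  let ?S = "vertex_sum E f"

  \<comment> \<open>Separation of the vertex sums\<close>
  have up_range: "k + 1 \<le> f (up v)" "f (up v) \<le> k + m" if "v \<in> V" "depth v > 0" for v
    using f_range up_in_E that by blast+

  have center_edge: "\<exists>w\<in>V. depth w = 1 \<and> parent w = c \<and> e = up w"
    if "depth c = 0" "e \<in> incident_edges E c" for c e
    using incident_cases[OF that(2)] that(1) by auto
  have center_ge: "3 * x \<le> ?S c"
    if c: "c \<in> V" "depth c = 0" and x: "x > 0"
      and le: "\<And>w. \<lbrakk>w \<in> V; depth w = 1\<rbrakk> \<Longrightarrow> x \<le> f (up w)" for c x
  proof -
    have "vertex_degree E c \<ge> 3"
      using depth_eq_0_iff c by fastforce
    then have "3 * x \<le> int (vertex_degree E c) * x"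
      using x by (intro mult_right_mono) auto
    also have "\<dots> \<le> ?S c"
      unfolding vertex_sum_def vertex_degree_def
      using sum_bounded_below[of "incident_edges E c" x f] center_edge[OF c(2)] le by force
    finally show ?thesis .
  qed

  have center_noncenter: "?S v < ?S c"
    if c: "c \<in> V" "depth c = 0" and v: "v \<in> V" "depth v > 0" for c v
    using v
  proof (cases rule: noncenter_sum[where f = f])
    case leaf
    \<comment> \<open>A leaf has sum at most \<open>k + m\<close>, and
      \<open>k + m < 3 * (k + 1)\<close> because \<open>k \<ge> m - 1\<close>.\<close>
    have "3 * (k + 1) \<le> ?S c"
      using m by (intro center_ge c up_range(1)) auto
    then show ?thesis
      using leaf up_range[OF v] m by simp
  next
    case (inner w)
    have w: "k + 1 \<le> f (up w)"
      using up_range(1)[of w] inner(1,2) by simp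
    \<comment> \<open>As a child of a noncenter, \<open>w\<close> has depth at least two, so its
      upward edge is labeled before all edges at centers.\<close>
    have "f (up w) + 1 \<le> f (up u)" if "u \<in> V" "depth u = 1" for u
      using deeper[of u w] that inner v by simp
    then have "3 * (f (up w) + 1) \<le> ?S c"
      using w m by (intro center_ge c) auto
    then show ?thesis
      using inner(4) w up_range[OF v] m by simp
  qed

  have center_less: "?S c < ?S c'"
    if c: "c \<in> V" "depth c = 0" and c': "c' \<in> V" "depth c' = 0"
      and less: "(vertex_degree E c, idx c) < (vertex_degree E c', idx c')" for c c'
    unfolding vertex_sum_def
  proof (rule sum_less_sum_of_dominated)
    show "incident_edges E c \<noteq> {}"
      using depth_eq_0_iff c by (force simp: vertex_degree_def)
    show "card (incident_edges E c) \<le> card (incident_edges E c')"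
      using less by (auto simp: vertex_degree_def)
    show "0 < f e" if e: "e \<in> incident_edges E c" for e
      using f_range(1)[of e] m e by (auto simp: incident_edges_def)
    show "f e < f e'" if e: "e \<in> incident_edges E c" "e' \<in> incident_edges E c'" for e e'
    proof -
      obtain w w' where w: "w \<in> V" "depth w = 1" "parent w = c" "e = up w"
        and w': "w' \<in> V" "depth w' = 1" "parent w' = c'" "e' = up w'"
        using center_edge[OF c(2) e(1)] center_edge[OF c'(2) e(2)] by blast
      \<comment> \<open>All these edges have lower ends at depth one, where degree and index of the
        center decide; hence every edge at \<open>c\<close> is labeled before every edge at
        \<open>c'\<close>.\<close>
      then have "legkey w < legkey w'"
        using less by (auto simp: legkey_def leg_depth_1)
      then show ?thesis
        using same_depth[of w w'] w w' by simp
    qed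
  qed (rule finite_incident)+

  have inner_less: "f (up v) + f (up w) < f (up v') + f (up w')"
    if v: "v \<in> V" "depth v > 0" and v': "v' \<in> V" "depth v' > 0"
      and w: "w \<in> V" "depth w = Suc (depth v)" "parent w = v"
      and w': "w' \<in> V" "depth w' = Suc (depth v')" "parent w' = v'"
      and less: "key v < key v'" for v w v' w'
  proof (cases "depth v' < depth v")
    case True
    then show ?thesis
      using deeper[of v' v] deeper[of w' w] v v' w w' by simp
  next
    case False
    with less have *: "depth v = depth v'" "legkey v < legkey v'"
      by (auto simp: key_def)
    \<comment> \<open>A child inherits the leg key, so the lower edges compare in the same way as
      the upper ones.\<close>
    moreover have "legkey w = legkey v" "legkey w' = legkey v'"
      using leg_child v v' w w' by (simp_all add: legkey_def)
    ultimately show ?thesis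
      using same_depth[of v v'] same_depth[of w w'] v v' w w' by simp
  qed

  have noncenter_neq: "?S v \<noteq> ?S v'"
    if v: "v \<in> V" "depth v > 0" and v': "v' \<in> V" "depth v' > 0" and "v \<noteq> v'" for v v'
    using v
  proof (cases rule: noncenter_sum[where f = f])
    case leaf
    note vleaf = leaf
    show ?thesis
      using v'
    proof (cases rule: noncenter_sum[where f = f])
      case leaf
      have "up v \<noteq> up v'"
        using up_eq_iff v v' \<open>v \<noteq> v'\<close> by blast
      then show ?thesis
        using f_bij up_in_E v v' unfolding vleaf leaf bij_betw_def by (metis inj_onD)
    next
      case (inner w')
      \<comment> \<open>Two labels add up to at least \<open>2 * (k + 1)\<close>, whereas a single
        one is at most \<open>k + m \<le> 2 * k + 1\<close>.\<close>
      then show ?thesis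
        using vleaf up_range[OF v] up_range[OF v'] up_range[of w'] m by simp
    qed
  next
    case (inner w)
    note vinner = inner
    show ?thesis
      using v'
    proof (cases rule: noncenter_sum[where f = f])
      case leaf
      then show ?thesis
        using vinner up_range[OF v] up_range[OF v'] up_range[of w] m by simp
    next
      case (inner w')
      have "key v \<noteq> key v'"
        using legkey_inj v v' \<open>v \<noteq> v'\<close> by (auto simp: key_def)
      then consider "key v < key v'" | "key v' < key v"
        by (meson linorder_neqE)
      then show ?thesis
        using inner_less[OF v v' vinner(1-3) inner(1-3)]
          inner_less[OF v' v inner(1-3) vinner(1-3)] vinner(4) inner(4)
        by cases simp_all
    qed
  qed

  have "?S u \<noteq> ?S v" if uv: "u \<in> V" "v \<in> V" "u \<noteq> v" for u v
  proof (cases "depth u = 0"; cases "depth v = 0")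
    assume d: "depth u = 0" "depth v = 0"
    have "(vertex_degree E u, idx u) \<noteq> (vertex_degree E v, idx v)"
      using idx uv by (auto dest: inj_onD)
    then consider "(vertex_degree E u, idx u) < (vertex_degree E v, idx v)"
      | "(vertex_degree E v, idx v) < (vertex_degree E u, idx u)"
      by (meson linorder_neqE)
    then show ?thesis
      using center_less[of u v] center_less[of v u] uv d by cases simp_all
  qed (use uv center_noncenter[of u v] center_noncenter[of v u] noncenter_neq[of u v] in simp_all)
  then show ?thesis
    using f_bij unfolding shifted_antimagic_def shifted_antimagic_labeling_def m_def by blast
qed

end

section \<open>From components to reachability\<close>

lemma spider_forest_centered:
  assumes "spider_forest V E"
  shows "centered_forest V E"
proof
  show simple: "simple_graph V E"
    using assms by (simp add: spider_forest_def)
  let ?R = "(adjacency E)\<^sup>*"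
  have edge_V: "u \<in> V \<and> v \<in> V" if "{u, v} \<in> E" for u v
    using simple that unfolding simple_graph_def by (auto simp: doubleton_eq_iff)
  have comp: "spider (?R `` {v}) {e \<in> E. e \<subseteq> ?R `` {v}}" if "v \<in> V" for v
    using assms that by (auto simp: spider_forest_def graph_components_def Let_def)
  \<comment> \<open>Every edge at \<open>w\<close> stays in the class of \<open>w\<close>, so
    degrees in the component and in the whole graph agree.\<close>
  have degree: "vertex_degree {e \<in> E. e \<subseteq> ?R `` {v}} w = vertex_degree E w"
    if "(v, w) \<in> ?R" for v w
  proof -
    have "e \<subseteq> ?R `` {v}" if "e \<in> E" "w \<in> e" for e
    proof -
      obtain x where x: "e = {w, x}"
        using simple \<open>e \<in> E\<close> \<open>w \<in> e\<close> unfolding simple_graph_def by blast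
      then have "(w, x) \<in> adjacency E"
        using \<open>e \<in> E\<close> by (simp add: adjacency_def)
      with x \<open>(v, w) \<in> ?R\<close> show ?thesis
        by (auto intro: rtrancl_into_rtrancl)
    qed
    then have "incident_edges {e \<in> E. e \<subseteq> ?R `` {v}} w = incident_edges E w"
      by (auto simp: incident_edges_def)
    then show ?thesis
      by (simp add: vertex_degree_def)
  qed
  have ex1: "\<exists>!w. (v, w) \<in> ?R \<and> vertex_degree E w > 2" if "v \<in> V" for v
  proof -
    have "\<exists>!w. (v, w) \<in> ?R \<and> vertex_degree {e \<in> E. e \<subseteq> ?R `` {v}} w > 2"
      using comp[OF that] by (simp add: spider_def)
    then show ?thesis
      using degree by (metis (no_types, lifting))
  qed
  then show "\<exists>c. (v, c) \<in> ?R \<and> vertex_degree E c > 2" if "v \<in> V" for v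
    using that by blast
  show "c = c'" if "(c, c') \<in> ?R" "vertex_degree E c > 2" "vertex_degree E c' > 2" for c c'
  proof -
    have "incident_edges E c \<noteq> {}"
      using that(2) by (auto simp: vertex_degree_def)
    then have "c \<in> V"
      using simple by (auto simp: incident_edges_def simple_graph_def)
    then show ?thesis
      using ex1 that by blast
  qed
  show "\<nexists>vs. graph_cycle E vs"
  proof
    assume "\<exists>vs. graph_cycle E vs"
    then obtain vs where vs: "graph_cycle E vs" ..
    let ?C = "?R `` {hd vs}"
    have "hd vs \<in> V"
      using vs edge_V by (auto simp: graph_cycle_def)
    have succ: "successively (\<lambda>u v. {u, v} \<in> E) vs"
      using vs by (simp add: graph_cycle_def)
    \<comment> \<open>A cycle is connected, so it lies wholly in the component of its first
      vertex.\<close>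
    have sub: "set vs \<subseteq> ?C"
      using successively_adjacency_reach[OF succ] by blast
    have "successively (\<lambda>u v. {u, v} \<in> {e \<in> E. e \<subseteq> ?C}) vs"
      using succ by (rule successively_mono) (use sub in auto)
    moreover have "vs \<noteq> []"
      using vs by (auto simp: graph_cycle_def)
    then have "last vs \<in> ?C"
      using sub last_in_set by blast
    ultimately have "graph_cycle {e \<in> E. e \<subseteq> ?C} vs"
      using vs by (simp add: graph_cycle_def)
    then show False
      using comp[OF \<open>hd vs \<in> V\<close>] by (auto simp: spider_def tree_graph_def)
  qed
qed

section \<open>Negative shifts\<close>

text \<open>Negating the labels negates all vertex sums and, with \<open>m = card E\<close>, carries
  \<open>{k + 1..k + m}\<close> to \<open>{- k - m..- k - 1}\<close>, the label range of the shift
  \<open>- k - m - 1\<close>.\<close>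

lemma shifted_antimagic_reflect:
  assumes "shifted_antimagic k V E"
  shows "shifted_antimagic (- k - int (card E) - 1) V E"
proof -
  obtain f where f: "bij_betw f E {k + 1..k + int (card E)}"
    "\<forall>u\<in>V. \<forall>v\<in>V. u \<noteq> v \<longrightarrow> vertex_sum E f u \<noteq> vertex_sum E f v"
    using assms by (auto simp: shifted_antimagic_def shifted_antimagic_labeling_def)
  have "bij_betw uminus {k + 1..k + int (card E)} {- (k + int (card E))..- (k + 1)}"
    by (simp add: bij_betw_def)
  from bij_betw_trans[OF f(1) this]
  have "bij_betw (\<lambda>e. - f e) E
    {(- k - int (card E) - 1) + 1..(- k - int (card E) - 1) + int (card E)}"
    by (simp add: comp_def algebra_simps)
  moreover have "vertex_sum E (\<lambda>e. - f e) v = - vertex_sum E f v" for v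
    by (simp add: vertex_sum_def sum_negf)
  ultimately show ?thesis
    using f(2) unfolding shifted_antimagic_def shifted_antimagic_labeling_def
    by (intro exI[of _ "\<lambda>e. - f e"]) simp
qed

theorem theorem2:
  fixes V :: "'a set" and E :: "'a set set" and m :: nat
  assumes "spider_forest V E"
    and "m = card E"
  shows "\<exists>k\<^sub>0::int. 0 < k\<^sub>0 \<and> k\<^sub>0 < int m \<and>
    (\<forall>k::int. k \<ge> k\<^sub>0 \<longrightarrow> shifted_antimagic k V E) \<and>
    (\<forall>k::int. k \<le> - (int m + k\<^sub>0 + 1) \<longrightarrow> shifted_antimagic k V E)"
proof -
  interpret centered_forest V E
    using assms(1) by (rule spider_forest_centered)
  \<comment> \<open>With \<open>k\<^sub>0 = m - 1\<close> the bound reads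
    \<open>k \<le> - 2 * m\<close>, that is \<open>- k - m - 1 \<ge> m - 1\<close>; reflecting this
    shift returns \<open>k\<close>.\<close>
  have "shifted_antimagic k V E" if "k \<le> - (int m + (int m - 1) + 1)" for k
    using shifted_antimagic_reflect[OF shifted_antimagic_large_shift[of "- k - int m - 1"]]
      that assms(2) by simp
  then show ?thesis
    using edge_count_ge_3 shifted_antimagic_large_shift assms(2)
    by (intro exI[of _ "int m - 1"]) auto
qed

end
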